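(* Let $(V,E)$ be a finite simple graph with Whitney complex $G$, let $R$ be a totally ordered set, and let $g:V\to R$ be locally injective, meaning $g(v)\neq g(w)$ whenever $(v,w)\in E$. Then $\chi(G)=\sum_{v\in V} i_g(v)$, where $i_g(v)=1-\chi(S_g^-(v))$.
   Context: The Whitney complex of a finite simple graph is the set of all non-empty vertex sets of complete subgraphs. A simplex $x$ with $k+1$ vertices has dimension $k$ and $\omega(x)=(-1)^{k}$; the Euler characteristic of a graph or complex is the sum of $\omega(x)$ over all its simplices (so the empty graph has Euler characteristic $0$). The unit sphere $S(v)$ is the subgraph induced by the neighbors of $v$, and $S_g^-(v)$ is the subgraph of $S(v)$ induced by $\{w\in S(v): g(w)<g(v)\}$; $\chi(S_g^-(v))$ is the Euler characteristic of that graph. *)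

theory Defs
  imports "Graph_Theory.Graph_Theory"
begin

text \<open>
  A finite simple graph is a digraph \<open>\<Gamma>\<close> satisfying the locale predicate \<^const>\<open>graph\<close>: finite,
  without loops or parallel arcs, and symmetric. An undirected edge between \<open>v\<close> and \<open>w\<close> is the
  pair of arcs \<open>v \<rightarrow> w\<close> and \<open>w \<rightarrow> v\<close>, so \<open>(v, w) \<in> E\<close> reads \<open>(v, w) \<in> arcs_ends \<Gamma>\<close>.
  The null graph is allowed.
\<close>

definition whitney_complex :: "('a, 'b) pre_digraph \<Rightarrow> 'a set set" where
  "whitney_complex \<Gamma> =
     {verts H | H. subgraph H \<Gamma> \<and> complete_digraph (card (verts H)) H \<and> verts H \<noteq> {}}"

text \<open>Natural-number subtraction is harmless here, as simplices are finite and non-empty.\<close>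

definition simplex_dim :: "'a set \<Rightarrow> nat" where
  "simplex_dim x = card x - 1"

definition \<omega> :: "'a set \<Rightarrow> int" where
  "\<omega> x = (- 1) ^ simplex_dim x"

definition euler_char :: "'a set set \<Rightarrow> int" where
  "euler_char C = (\<Sum>x\<in>C. \<omega> x)"

definition graph_euler_char :: "('a, 'b) pre_digraph \<Rightarrow> int" where
  "graph_euler_char \<Gamma> = euler_char (whitney_complex \<Gamma>)"

definition unit_sphere :: "('a, 'b) pre_digraph \<Rightarrow> 'a \<Rightarrow> ('a, 'b) pre_digraph" where
  "unit_sphere \<Gamma> v = \<Gamma> \<restriction> {w \<in> verts \<Gamma>. v \<rightarrow>\<^bsub>\<Gamma>\<^esub> w}"

definition lower_sphere ::
  "('a, 'b) pre_digraph \<Rightarrow> ('a \<Rightarrow> 'r::linorder) \<Rightarrow> 'a \<Rightarrow> ('a, 'b) pre_digraph" where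
  "lower_sphere \<Gamma> g v = unit_sphere \<Gamma> v \<restriction> {w \<in> verts (unit_sphere \<Gamma> v). g w < g v}"

definition locally_injective :: "('a, 'b) pre_digraph \<Rightarrow> ('a \<Rightarrow> 'r) \<Rightarrow> bool" where
  "locally_injective \<Gamma> g \<longleftrightarrow> (\<forall>v w. (v, w) \<in> arcs_ends \<Gamma> \<longrightarrow> g v \<noteq> g w)"

definition poincare_hopf_index ::
  "('a, 'b) pre_digraph \<Rightarrow> ('a \<Rightarrow> 'r::linorder) \<Rightarrow> 'a \<Rightarrow> int" where
  "poincare_hopf_index \<Gamma> g v = 1 - graph_euler_char (lower_sphere \<Gamma> g v)"

end

theory Submission
  imports Defs
begin

text \<open>
  By local injectivity every simplex has a unique vertex \<open>v\<close> at which \<open>g\<close> is maximal. The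
  simplices with maximal vertex \<open>v\<close> are \<open>{v}\<close> and the joins of \<open>v\<close> with a simplex of
  \<open>S\<^sub>g\<^sup>-(v)\<close>. Adding \<open>v\<close> to a simplex raises its dimension by one, so together they contribute
  \<open>1 - \<chi>(S\<^sub>g\<^sup>-(v))\<close> to the Euler characteristic.
\<close>

lemma arcs_ends_induce_subgraph: "arcs_ends (G \<restriction> S) = arcs_ends G \<inter> S \<times> S"
  by (auto simp: arcs_ends_conv)

lemma (in graph) graph_induce_subgraph:
  assumes "S \<subseteq> verts G"
  shows "graph (G \<restriction> S)"
proof -
  have ind: "induced_subgraph (G \<restriction> S) G"
    using assms by (rule induced_induce)
  interpret D: digraph "G \<restriction> S"
    using ind by (rule digraphI_induced)
  show ?thesis
    using induced_graph_imp_symmetric[OF sym_arcs ind] by (rule D.graphI)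
qed

text \<open>Adjacency is inherited from a complete subgraph by \<open>G\<close>; conversely, a
  clique \<open>x\<close> induces a complete subgraph, so \<open>G \<restriction> x\<close> serves
  as the witness \<open>H\<close>. This trades the existential over subgraphs for a condition on
  vertex sets alone.\<close>

lemma (in graph) whitney_complex_iff:
  "x \<in> whitney_complex G \<longleftrightarrow>
     x \<noteq> {} \<and> x \<subseteq> verts G \<and> (\<forall>u\<in>x. \<forall>w\<in>x. u \<noteq> w \<longrightarrow> u \<rightarrow>\<^bsub>G\<^esub> w)"
  (is "_ \<longleftrightarrow> ?R")
proof
  assume "x \<in> whitney_complex G"
  then obtain H where H: "x = verts H" "subgraph H G" "complete_digraph (card (verts H)) H"
      "verts H \<noteq> {}"
    by (auto simp: whitney_complex_def)
  show ?R
    using H arcs_ends_mono[OF H(2)] by (auto simp: complete_digraph_def subgraph_def)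
next
  assume R: ?R
  have "subgraph (G \<restriction> x) G"
    using R by (intro induced_imp_subgraph induced_induce) simp
  \<comment> \<open>Completeness demands that the arcs be exactly the pairs of distinct vertices, so
    the absence of loops is used as well.\<close>
  moreover have "complete_digraph (card x) (G \<restriction> x)"
    unfolding complete_digraph_def arcs_ends_induce_subgraph
    using R by (auto simp: graph_induce_subgraph dest: adj_not_same)
  ultimately show "x \<in> whitney_complex G"
    unfolding whitney_complex_def using R
    by (intro CollectI exI[of _ "G \<restriction> x"]) simp
qed

lemma (in graph) finite_whitney_complex: "finite (whitney_complex G)"
  by (rule finite_subset[of _ "Pow (verts G)"]) (auto simp: whitney_complex_iff)

lemma (in graph) finite_simplex: "x \<in> whitney_complex G \<Longrightarrow> finite x"
  by (auto simp: whitney_complex_iff intro: finite_subset)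

text \<open>The case \<open>x = {}\<close> must be excluded: truncated subtraction gives the empty
  set dimension 0, the same as a singleton, so the sign would not flip.\<close>

lemma \<omega>_insert:
  assumes "finite x" "x \<noteq> {}" "v \<notin> x"
  shows "\<omega> (insert v x) = - \<omega> x"
proof -
  obtain n where "card x = Suc n"
    using assms by (cases "card x") auto
  then show ?thesis
    using assms by (simp add: \<omega>_def simplex_dim_def)
qed

lemma lower_sphere_eq:
  "lower_sphere G g v = G \<restriction> {w \<in> verts G. v \<rightarrow>\<^bsub>G\<^esub> w \<and> g w < g v}"
  by (auto simp: lower_sphere_def unit_sphere_def induce_subgraph_def)

text \<open>An induced subgraph of a graph is again a graph with the inherited adjacency, so the
  clique description applies to both sides.\<close>

lemma (in graph) whitney_complex_lower_sphere_iff: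
  "y \<in> whitney_complex (lower_sphere G g v) \<longleftrightarrow>
     y \<in> whitney_complex G \<and> (\<forall>w\<in>y. v \<rightarrow>\<^bsub>G\<^esub> w \<and> g w < g v)"
proof -
  interpret L: graph "lower_sphere G g v"
    unfolding lower_sphere_eq by (rule graph_induce_subgraph) blast
  show ?thesis
    unfolding L.whitney_complex_iff whitney_complex_iff
    by (auto simp: lower_sphere_eq arcs_ends_induce_subgraph subset_iff)
qed

text \<open>The inequality is strict so that a simplex has at most one peak.\<close>

definition peak_simplices :: "('a, 'b) pre_digraph \<Rightarrow> ('a \<Rightarrow> 'r::linorder) \<Rightarrow> 'a \<Rightarrow> 'a set set"
  where "peak_simplices G g v =
    {x \<in> whitney_complex G. v \<in> x \<and> (\<forall>w\<in>x - {v}. g w < g v)}"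

text \<open>Deleting \<open>v\<close> inverts the join with \<open>v\<close>. The singleton is
  listed separately because deleting \<open>v\<close> from it leaves the empty set, which is not a
  simplex.\<close>

lemma (in graph) peak_simplices_eq:
  assumes "v \<in> verts G"
  shows "peak_simplices G g v =
    insert {v} (insert v ` whitney_complex (lower_sphere G g v))"
proof (intro equalityI subsetI)
  fix x
  assume x: "x \<in> peak_simplices G g v"
  show "x \<in> insert {v} (insert v ` whitney_complex (lower_sphere G g v))"
  proof (cases "x = {v}")
    case False
    have "x - {v} \<in> whitney_complex (lower_sphere G g v)"
      using x False unfolding whitney_complex_lower_sphere_iff
      by (auto simp: peak_simplices_def whitney_complex_iff)
    moreover have "x = insert v (x - {v})"
      using x by (auto simp: peak_simplices_def)
    ultimately show ?thesis
      by blast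
  qed simp
next
  fix x
  assume "x \<in> insert {v} (insert v ` whitney_complex (lower_sphere G g v))"
  then consider "x = {v}" | y where "x = insert v y" "y \<in> whitney_complex (lower_sphere G g v)"
    by blast
  then show "x \<in> peak_simplices G g v"
  proof cases
    case 1
    then show ?thesis
      using assms by (simp add: peak_simplices_def whitney_complex_iff)
  next
    case 2
    then have y: "y \<in> whitney_complex G" "\<forall>w\<in>y. v \<rightarrow>\<^bsub>G\<^esub> w \<and> g w < g v"
      by (simp_all add: whitney_complex_lower_sphere_iff)
    \<comment> \<open>The clique condition ranges over ordered pairs, so the reverse arcs are needed
      too.\<close>
    moreover have "\<forall>w\<in>y. w \<rightarrow>\<^bsub>G\<^esub> v"
      using y(2) by (blast intro: arcs_ends_symmetric[OF sym_arcs])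
    ultimately show ?thesis
      using assms 2(1) by (simp add: peak_simplices_def whitney_complex_iff)
  qed
qed

lemma (in graph) euler_char_peak_simplices:
  assumes "v \<in> verts G"
  shows "euler_char (peak_simplices G g v) = poincare_hopf_index G g v"
proof -
  let ?L = "whitney_complex (lower_sphere G g v)"
  have L: "finite y" "y \<noteq> {}" "v \<notin> y" if "y \<in> ?L" for y
  proof -
    have y: "y \<in> whitney_complex G" "\<forall>w\<in>y. g w < g v"
      using that by (simp_all add: whitney_complex_lower_sphere_iff)
    show "finite y" "y \<noteq> {}"
      using y(1) by (simp_all add: finite_simplex whitney_complex_iff)
    show "v \<notin> y"
      using y(2) by blast
  qed
  have "finite ?L"
    by (rule finite_subset[OF _ finite_whitney_complex])
      (auto simp: whitney_complex_lower_sphere_iff)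
  \<comment> \<open>This and the injectivity below ensure that no simplex is counted twice when the
    sum is split and reindexed over \<open>?L\<close>.\<close>
  moreover have "{v} \<notin> insert v ` ?L"
    using L(2,3) by blast
  moreover have "inj_on (insert v) ?L"
    using L(3) by (auto intro!: inj_onI simp: insert_ident)
  ultimately have "euler_char (peak_simplices G g v) = \<omega> {v} + (\<Sum>y\<in>?L. \<omega> (insert v y))"
    by (simp add: euler_char_def peak_simplices_eq[OF assms] sum.reindex)
  also have "(\<Sum>y\<in>?L. \<omega> (insert v y)) = - (\<Sum>y\<in>?L. \<omega> y)"
    using L by (simp add: \<omega>_insert sum_negf)
  finally show ?thesis
    by (simp add: poincare_hopf_index_def graph_euler_char_def euler_char_def \<omega>_def
        simplex_dim_def)
qed

text \<open>Distinct vertices of a simplex are adjacent, so local injectivity rules out ties and the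
  maximum of \<open>g\<close> on the simplex is strict.\<close>

lemma (in graph) whitney_complex_eq_Union_peak_simplices:
  assumes "locally_injective G g"
  shows "whitney_complex G = (\<Union>v\<in>verts G. peak_simplices G g v)"
proof (intro equalityI subsetI)
  fix x
  assume x: "x \<in> whitney_complex G"
  have "finite (g ` x)" "g ` x \<noteq> {}"
    using x finite_simplex[OF x] by (simp_all add: whitney_complex_iff)
  then obtain v where v: "v \<in> x" "g v = Max (g ` x)"
    by (metis Max_in imageE)
  have "g w < g v" if "w \<in> x - {v}" for w
  proof -
    have "g w \<le> g v"
      using that v(2) \<open>finite (g ` x)\<close> by simp
    moreover have "g w \<noteq> g v"
      using that v(1) x assms by (auto simp: whitney_complex_iff locally_injective_def)
    ultimately show ?thesis
      by simp
  qed
  then have "x \<in> peak_simplices G g v"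
    using v(1) x by (simp add: peak_simplices_def)
  moreover have "v \<in> verts G"
    using v(1) x by (auto simp: whitney_complex_iff)
  ultimately show "x \<in> (\<Union>v\<in>verts G. peak_simplices G g v)"
    by blast
qed (auto simp: peak_simplices_def)

text \<open>Two distinct peaks of one simplex would each have to lie strictly below the
  other.\<close>

lemma peak_simplices_disjoint:
  assumes "v \<noteq> w"
  shows "peak_simplices G g v \<inter> peak_simplices G g w = {}"
proof (rule equals0I)
  fix x
  assume "x \<in> peak_simplices G g v \<inter> peak_simplices G g w"
  then have "g v < g w" "g w < g v"
    using assms by (simp_all add: peak_simplices_def)
  then show False
    by simp
qed

theorem mainTheorem2:
  fixes \<Gamma> :: "('a, 'b) pre_digraph"
    and g :: "'a \<Rightarrow> 'r::linorder"
  assumes "graph \<Gamma>"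
    and "locally_injective \<Gamma> g"
  shows "euler_char (whitney_complex \<Gamma>) = (\<Sum>v\<in>verts \<Gamma>. poincare_hopf_index \<Gamma> g v)"
proof -
  interpret graph \<Gamma>
    by fact
  have "finite (peak_simplices \<Gamma> g v)" for v
    by (rule finite_subset[OF _ finite_whitney_complex]) (auto simp: peak_simplices_def)
  then have "euler_char (whitney_complex \<Gamma>) =
      (\<Sum>v\<in>verts \<Gamma>. euler_char (peak_simplices \<Gamma> g v))"
    unfolding whitney_complex_eq_Union_peak_simplices[OF assms(2)] euler_char_def
    by (intro sum.UNION_disjoint) (simp_all add: peak_simplices_disjoint)
  then show ?thesis
    by (simp add: euler_char_peak_simplices)
qed

end
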